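(* Let $N, M$ be positive integers, let $\alpha,\beta\in(0,1)$, and let $w=(w_0,\dots,w_N)\in\mathbb{R}^{N+1}$. Let $f:\mathbb{R}\to\mathbb{R}$ be a non-linear function that is $L$-Lipschitz for some $L\ge 0$ with $\alpha L<\frac{1}{\sqrt{2}}$. For an input $u\in\mathbb{R}^M$ let $x_0^{(u)},\dots,x_N^{(u)}$ be the node states of the reservoir $X(N,f,\beta,\alpha)$ with nodes $x_0,\dots,x_N$ driven by $u$, and let $y_u(t)=\sum_{k=0}^{N} w_k x_k^{(u)}(t)$ be its output. Then for any two inputs $u,v\in\mathbb{R}^M$, $$\| y_u-y_v \|_{\ell^2(\mathbb{R}^M)}^2 \leq |w|^2\, M\,(L\beta)^2 (N+1) \left(1+\frac{2}{1-2\alpha^2 L^2} \right) \| u-v \|_{\ell^2(\mathbb{R}^M)}^2 .$$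
   Context: Time $t$ is discrete, $t\in\mathbb{Z}_{\ge 0}$. An input is a vector $u=(u(1),\dots,u(M))\in\mathbb{R}^M$, with the convention $u(0)=0$; reservoirs are considered over the time interval $t\in\{1,\dots,M\}$. The reservoir $X(N,f,\beta,\alpha)$ with $N+1$ nodes $x_0,\dots,x_N$, nonlinearity $f$, input gain $\beta$ and feedback gain $\alpha$, driven by the input $u$, is given by the node states $x_n^{(u)}(t)$ determined by $$x_n^{(u)}(0)=0\quad (0\le n\le N),$$ $$x_0^{(u)}(t)=f\big(\alpha x_N^{(u)}(t-1)+\beta u(t)\big)\quad (t\ge 1),$$ $$x_{n+1}^{(u)}(t)=x_n^{(u)}(t-1)\quad (0\le n\le N-1,\ t\ge 1).$$ The real numbers $w_0,\dots,w_N$ are the node weights, $|w|=\big(\sum_{k=0}^N w_k^2\big)^{1/2}$ is the Euclidean length of the weight vector, and the output over the time interval is the vector $y_u=(y_u(1),\dots,y_u(M))\in\mathbb{R}^M$. For $z\in\mathbb{R}^M$, $\|z\|_{\ell^2(\mathbb{R}^M)}=\big(\sum_{t=1}^M |z(t)|^2\big)^{1/2}$. A function $f:\mathbb{R}\to\mathbb{R}$ is $L$-Lipschitz if $|f(a)-f(b)|\le L|a-b|$ for all $a,b\in\mathbb{R}$. *)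

theory Defs
  imports "HOL-Analysis.L2_Norm" "HOL-Analysis.Lipschitz"
begin

text \<open>
  A vector in \<open>\<real>\<^sup>M\<close> is represented by a function \<open>nat \<Rightarrow> real\<close> of which only the values on
  \<open>{1..M}\<close> matter, and a weight vector by a function of which only the values on \<open>{0..N}\<close> matter.
  The Euclidean norm is then \<open>L2_set\<close> over that index set. The value \<open>u 0\<close> of an input never
  enters the dynamics, so the convention \<open>u 0 = 0\<close> need not be imposed.
\<close>

text \<open>
  \<open>reservoir_node N f \<beta> \<alpha> u t n\<close> is the state at time \<open>t\<close> of node \<open>n\<close> of the reservoir
  \<open>X(N,f,\<beta>,\<alpha>)\<close> driven by \<open>u\<close>. Only \<open>n \<le> N\<close> is meaningful: for \<open>n > N\<close> the equations merely
  continue the delay line, without influencing the nodes \<open>0..N\<close>.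
\<close>

fun reservoir_node ::
  "nat \<Rightarrow> (real \<Rightarrow> real) \<Rightarrow> real \<Rightarrow> real \<Rightarrow> (nat \<Rightarrow> real) \<Rightarrow> nat \<Rightarrow> nat \<Rightarrow> real"
where
  "reservoir_node N f \<beta> \<alpha> u 0 n = 0"
| "reservoir_node N f \<beta> \<alpha> u (Suc t) 0 =
     f (\<alpha> * reservoir_node N f \<beta> \<alpha> u t N + \<beta> * u (Suc t))"
| "reservoir_node N f \<beta> \<alpha> u (Suc t) (Suc n) = reservoir_node N f \<beta> \<alpha> u t n"

definition reservoir_output ::
  "nat \<Rightarrow> (real \<Rightarrow> real) \<Rightarrow> real \<Rightarrow> real \<Rightarrow> (nat \<Rightarrow> real) \<Rightarrow> (nat \<Rightarrow> real) \<Rightarrow> nat \<Rightarrow> real"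
where
  "reservoir_output N f \<beta> \<alpha> w u t = (\<Sum>k=0..N. w k * reservoir_node N f \<beta> \<alpha> u t k)"

end

theory Submission
  imports Defs
begin

text \<open>
  The difference of two trajectories is controlled by its energy at the entry node
  \<open>x\<^sub>0\<close>. The delay line only translates this signal in time, and the part shifted in at the front
  is zero because both reservoirs start at rest; so on \<open>{1..M}\<close> no node carries more energy than
  \<open>x\<^sub>0\<close> does (\<open>delay_node_energy_le\<close>). In particular this holds for the node \<open>x\<^sub>N\<close> that is fed
  back, so squaring the Lipschitz estimate at the entry node and summing over time bounds the
  energy \<open>S\<close> of \<open>x\<^sub>0\<close> by itself,
  \<open>S \<le> 2 (\<alpha> L)\<^sup>2 S + 2 (L \<beta>)\<^sup>2 \<parallel>u - v\<parallel>\<^sup>2\<close>. Since \<open>2 (\<alpha> L)\<^sup>2 < 1\<close>, this can be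
  solved for \<open>S\<close> (\<open>entry_node_energy_le\<close>).

  The output is a weighted sum over the nodes, so the Cauchy-Schwarz inequality at each time bounds
  its energy by \<open>\<bar>w\<bar>\<^sup>2 (N + 1) S\<close>. The resulting constant
  \<open>2 / (1 - 2 \<alpha>\<^sup>2 L\<^sup>2)\<close> is at most \<open>M (1 + 2 / (1 - 2 \<alpha>\<^sup>2 L\<^sup>2))\<close>.
\<close>

lemma L2_set_squared: "(L2_set g A)\<^sup>2 = (\<Sum>i\<in>A. (g i)\<^sup>2)"
  by (simp add: L2_set_def sum_nonneg)

lemma sum_mult_squared_le_L2_set:
  fixes a b :: "'i \<Rightarrow> real"
  shows "(\<Sum>i\<in>A. a i * b i)\<^sup>2 \<le> (L2_set a A)\<^sup>2 * (L2_set b A)\<^sup>2"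
proof -
  have "\<bar>\<Sum>i\<in>A. a i * b i\<bar> \<le> (\<Sum>i\<in>A. \<bar>a i\<bar> * \<bar>b i\<bar>)"
    by (rule order_trans[OF sum_abs]) (simp add: abs_mult)
  also have "\<dots> \<le> L2_set a A * L2_set b A"
    by (rule L2_set_mult_ineq)
  finally have "\<bar>\<Sum>i\<in>A. a i * b i\<bar>\<^sup>2 \<le> (L2_set a A * L2_set b A)\<^sup>2"
    by (rule power_mono) simp
  then show ?thesis
    by (simp add: power_mult_distrib)
qed

text \<open>
  Delaying a signal that starts from zero pushes its last value out of the observation window
  and brings in nothing at the front.
\<close>

lemma sum_delayed_le:
  fixes a :: "nat \<Rightarrow> real"
  assumes "a 0 = 0" and "\<And>t. a t \<ge> 0"
  shows "(\<Sum>t=1..M. a (t - 1)) \<le> (\<Sum>t=1..M. a t)"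
proof -
  have "(\<Sum>t=1..M. a (t - 1)) + a M = (\<Sum>t=1..M. a t)"
    using assms(1) by (induction M) auto
  with assms(2)[of M] show ?thesis
    by linarith
qed

lemma delay_node_energy_le:
  "(\<Sum>t=1..M. (reservoir_node N f \<beta> \<alpha> u t n - reservoir_node N f \<beta> \<alpha> v t n)\<^sup>2)
    \<le> (\<Sum>t=1..M. (reservoir_node N f \<beta> \<alpha> u t 0 - reservoir_node N f \<beta> \<alpha> v t 0)\<^sup>2)"
proof (induction n)
  case (Suc n)
  let ?d = "\<lambda>t n. reservoir_node N f \<beta> \<alpha> u t n - reservoir_node N f \<beta> \<alpha> v t n"
  have "?d t (Suc n) = ?d (t - 1) n" if "t \<in> {1..M}" for t
    using that by (cases t) auto
  then have "(\<Sum>t=1..M. (?d t (Suc n))\<^sup>2) = (\<Sum>t=1..M. (?d (t - 1) n)\<^sup>2)"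
    by (intro sum.cong) simp_all
  also have "\<dots> \<le> (\<Sum>t=1..M. (?d t n)\<^sup>2)"
    by (rule sum_delayed_le) simp_all
  finally show ?case
    using Suc.IH by linarith
qed simp

text \<open>
  The feedback term is dominated by the very energy that is being estimated, with a factor below
  one, so it can be absorbed into the left-hand side. The factor 2 comes from squaring the sum of
  the feedback and the input contribution.
\<close>

lemma entry_node_energy_le:
  fixes \<alpha> \<beta> L :: real and f :: "real \<Rightarrow> real" and u v :: "nat \<Rightarrow> real"
  assumes lip: "L-lipschitz_on UNIV f" and small: "2 * \<alpha>\<^sup>2 * L\<^sup>2 < 1"
  shows "(\<Sum>t=1..M. (reservoir_node N f \<beta> \<alpha> u t 0 - reservoir_node N f \<beta> \<alpha> v t 0)\<^sup>2)
    \<le> 2 / (1 - 2 * \<alpha>\<^sup>2 * L\<^sup>2) * (L * \<beta>)\<^sup>2 * (\<Sum>t=1..M. (u t - v t)\<^sup>2)"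
proof -
  let ?d = "\<lambda>t n. reservoir_node N f \<beta> \<alpha> u t n - reservoir_node N f \<beta> \<alpha> v t n"
  define S where "S = (\<Sum>t=1..M. (?d t 0)\<^sup>2)"
  define E where "E = (\<Sum>t=1..M. (u t - v t)\<^sup>2)"
  have step: "(?d t 0)\<^sup>2 \<le> 2 * \<alpha>\<^sup>2 * L\<^sup>2 * (?d (t - 1) N)\<^sup>2 + 2 * (L * \<beta>)\<^sup>2 * (u t - v t)\<^sup>2"
    if "t \<in> {1..M}" for t
  proof -
    obtain s where t: "t = Suc s"
      using \<open>t \<in> {1..M}\<close> by (cases t) auto
    have "\<bar>?d t 0\<bar> \<le> L * \<bar>\<alpha> * ?d s N + \<beta> * (u t - v t)\<bar>"
      using lipschitz_onD[OF lip UNIV_I UNIV_I,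
          of "\<alpha> * reservoir_node N f \<beta> \<alpha> u s N + \<beta> * u t"
             "\<alpha> * reservoir_node N f \<beta> \<alpha> v s N + \<beta> * v t"]
      by (simp add: t dist_real_def algebra_simps)
    then have "(?d t 0)\<^sup>2 \<le> (L * (\<alpha> * ?d s N + \<beta> * (u t - v t)))\<^sup>2"
      using lipschitz_on_nonneg[OF lip] by (intro abs_le_square_iff[THEN iffD1]) (simp add: abs_mult)
    also have "\<dots> = (\<alpha> * L * ?d s N + L * \<beta> * (u t - v t))\<^sup>2"
      by (simp add: algebra_simps)
    also have "\<dots> \<le> 2 * (\<alpha> * L * ?d s N)\<^sup>2 + 2 * (L * \<beta> * (u t - v t))\<^sup>2"
    proof -
      have "(a + b)\<^sup>2 \<le> 2 * a\<^sup>2 + 2 * b\<^sup>2" for a b :: real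
        using zero_le_power2[of "a - b"] by (simp add: power2_sum power2_diff)
      then show ?thesis .
    qed
    finally show ?thesis
      by (simp add: t power_mult_distrib mult.assoc)
  qed
  have "(\<Sum>t=1..M. (?d (t - 1) N)\<^sup>2) \<le> (\<Sum>t=1..M. (?d t N)\<^sup>2)"
    by (rule sum_delayed_le) simp_all
  also have "\<dots> \<le> S"
    unfolding S_def by (rule delay_node_energy_le)
  finally have feedback: "(\<Sum>t=1..M. (?d (t - 1) N)\<^sup>2) \<le> S" .
  have "S \<le> 2 * \<alpha>\<^sup>2 * L\<^sup>2 * (\<Sum>t=1..M. (?d (t - 1) N)\<^sup>2) + 2 * (L * \<beta>)\<^sup>2 * E"
    unfolding S_def E_def sum_distrib_left sum.distrib[symmetric] by (rule sum_mono) (rule step)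
  also have "\<dots> \<le> 2 * \<alpha>\<^sup>2 * L\<^sup>2 * S + 2 * (L * \<beta>)\<^sup>2 * E"
    by (intro add_right_mono mult_left_mono feedback) simp
  finally have "S * (1 - 2 * \<alpha>\<^sup>2 * L\<^sup>2) \<le> 2 * (L * \<beta>)\<^sup>2 * E"
    by (simp add: algebra_simps)
  then have "S \<le> 2 * (L * \<beta>)\<^sup>2 * E / (1 - 2 * \<alpha>\<^sup>2 * L\<^sup>2)"
    using small by (subst pos_le_divide_eq) simp_all
  then show ?thesis
    by (simp add: S_def E_def)
qed

theorem theorem3p5:
  fixes N M :: nat and \<alpha> \<beta> L :: real and w :: "nat \<Rightarrow> real"
    and f :: "real \<Rightarrow> real" and u v :: "nat \<Rightarrow> real"
  assumes "N \<ge> 1" and "M \<ge> 1"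
    and "\<alpha> \<in> {0<..<1}" and "\<beta> \<in> {0<..<1}"
    and "\<not> linear f"
    and "L \<ge> 0" and "L-lipschitz_on UNIV f"
    and "\<alpha> * L < 1 / sqrt 2"
  shows "(L2_set (\<lambda>t. reservoir_output N f \<beta> \<alpha> w u t - reservoir_output N f \<beta> \<alpha> w v t) {1..M})\<^sup>2
    \<le> (L2_set w {0..N})\<^sup>2 * real M * (L * \<beta>)\<^sup>2 * (real N + 1)
        * (1 + 2 / (1 - 2 * \<alpha>\<^sup>2 * L\<^sup>2)) * (L2_set (\<lambda>t. u t - v t) {1..M})\<^sup>2"
proof -
  let ?d = "\<lambda>t n. reservoir_node N f \<beta> \<alpha> u t n - reservoir_node N f \<beta> \<alpha> v t n"
  let ?W = "(L2_set w {0..N})\<^sup>2"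
  define S where "S = (\<Sum>t=1..M. (?d t 0)\<^sup>2)"
  define E where "E = (\<Sum>t=1..M. (u t - v t)\<^sup>2)"
  define C where "C = 2 / (1 - 2 * \<alpha>\<^sup>2 * L\<^sup>2)"
  have "(\<alpha> * L)\<^sup>2 < (1 / sqrt 2)\<^sup>2"
    using assms by (intro power_strict_mono) auto
  then have small: "2 * \<alpha>\<^sup>2 * L\<^sup>2 < 1"
    by (simp add: power_mult_distrib power_divide)
  then have "C \<ge> 0"
    by (simp add: C_def)
  have "E \<ge> 0"
    by (simp add: E_def sum_nonneg)
  have "reservoir_output N f \<beta> \<alpha> w u t - reservoir_output N f \<beta> \<alpha> w v t
      = (\<Sum>k=0..N. w k * ?d t k)" for t
    by (simp add: reservoir_output_def right_diff_distrib sum_subtractf)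
  then have "(L2_set (\<lambda>t. reservoir_output N f \<beta> \<alpha> w u t - reservoir_output N f \<beta> \<alpha> w v t) {1..M})\<^sup>2
      = (\<Sum>t=1..M. (\<Sum>k=0..N. w k * ?d t k)\<^sup>2)"
    by (simp add: L2_set_squared)
  also have "\<dots> \<le> (\<Sum>t=1..M. ?W * (L2_set (?d t) {0..N})\<^sup>2)"
    by (intro sum_mono sum_mult_squared_le_L2_set)
  also have "\<dots> = ?W * (\<Sum>t=1..M. \<Sum>k=0..N. (?d t k)\<^sup>2)"
    by (simp add: L2_set_squared sum_distrib_left)
  also have "\<dots> = ?W * (\<Sum>k=0..N. \<Sum>t=1..M. (?d t k)\<^sup>2)"
    by (subst sum.swap) simp
  also have "\<dots> \<le> ?W * (\<Sum>k=0..N. S)"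
    unfolding S_def by (intro mult_left_mono sum_mono delay_node_energy_le) simp
  also have "\<dots> = ?W * (real N + 1) * S"
    by simp
  also have "\<dots> \<le> ?W * (real N + 1) * (C * (L * \<beta>)\<^sup>2 * E)"
    unfolding S_def C_def E_def
    by (intro mult_left_mono entry_node_energy_le[OF assms(7) small]) simp
  also have "\<dots> = ?W * (real N + 1) * (L * \<beta>)\<^sup>2 * E * C"
    by (simp add: mult_ac)
  also have "\<dots> \<le> ?W * (real N + 1) * (L * \<beta>)\<^sup>2 * E * (real M * (1 + C))"
  proof (rule mult_left_mono)
    have "C \<le> 1 * (1 + C)"
      by simp
    also have "\<dots> \<le> real M * (1 + C)"
      using \<open>M \<ge> 1\<close> \<open>C \<ge> 0\<close> by (intro mult_right_mono) simp_all
    finally show "C \<le> real M * (1 + C)" .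
  qed (simp add: \<open>E \<ge> 0\<close>)
  finally show ?thesis
    by (simp add: C_def E_def L2_set_squared mult_ac)
qed

end
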